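(* Assume that there exists $M$ such that for all $x$ large enough, $\bigl|\mathscr{B}\cap[x,x+\sqrt{x}]\bigr|\le M$. Then, for any cylinder set $C\subset X$, $$\frac1{\sqrt N}\sum_{N\le n<N+\sqrt N}\mathbf{1}_C(S^n\eta)\longrightarrow\nu_{\mathscr{B}}(C)\qquad\text{as }N\to\infty.$$
   Context: $\mathbb{N}^*=\{1,2,3,\ldots\}$; $|A|$ denotes the cardinality of $A$. $\mathscr{B}=\{b_k:k\ge1\}\subset\{2,3,4,\ldots\}$ is a given infinite set of pairwise relatively prime integers with $\sum_{k\ge1}1/b_k<\infty$. $X=\{0,1\}^{\mathbb{N}^*}$, and $S:X\to X$ is the shift, $(Sx)_n=x_{n+1}$. A cylinder set is a subset of $X$ obtained by prescribing the values of finitely many coordinates. The sequence $\eta=(\eta_n)_{n\in\mathbb{N}^*}\in X$ is defined by $\eta_n=0$ if some $b_k$ divides $n$, and $\eta_n=1$ otherwise. $\Omega=\prod_{k\ge1}\mathbb{Z}/b_k\mathbb{Z}$ with normalized Haar measure $\mathbb{P}$. The map $\varphi:\Omega\to X$ is defined by: $\varphi(\omega)_n=0$ if there exists $k\ge1$ with $\omega_k+n\equiv0\bmod b_k$, and $\varphi(\omega)_n=1$ otherwise ($n\in\mathbb{N}^*$). $\nu_{\mathscr{B}}$ is the pushforward of $\mathbb{P}$ by $\varphi$: $\nu_{\mathscr{B}}(C)=\mathbb{P}(\varphi^{-1}C)$. *)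

theory Defs
  imports "HOL-Probability.Probability" "HOL-Number_Theory.Number_Theory"
begin

text \<open>Sequences indexed by the positive integers are extensional functions on \<open>{1..}\<close>
  (value \<open>undefined\<close> at the index \<open>0\<close>).\<close>

definition X :: "(nat \<Rightarrow> nat) set" where
  "X = (\<Pi>\<^sub>E n\<in>{1..}. {0, 1})"

definition X_algebra :: "(nat \<Rightarrow> nat) measure" where
  "X_algebra = (\<Pi>\<^sub>M n\<in>{1..}. count_space {0, 1})"

definition shift :: "(nat \<Rightarrow> nat) \<Rightarrow> nat \<Rightarrow> nat" where
  "shift x = (\<lambda>n\<in>{1..}. x (n + 1))"

definition cylinder :: "(nat \<Rightarrow> nat) set \<Rightarrow> bool" where
  "cylinder C \<longleftrightarrow>
    (\<exists>J a. finite J \<and> J \<subseteq> {1..} \<and> a \<in> J \<rightarrow> {0, 1} \<and> C = {x \<in> X. \<forall>n\<in>J. x n = a n})"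

definition eta :: "(nat \<Rightarrow> nat) \<Rightarrow> nat \<Rightarrow> nat" where
  "eta b = (\<lambda>n\<in>{1..}. if \<exists>k\<ge>1. b k dvd n then 0 else 1)"

text \<open>\<open>\<int>/b\<^sub>k\<int>\<close> is represented by its residues \<open>{0..<b k}\<close>; the normalized Haar measure of the
  product is the product of the uniform probabilities, on the product of the discrete
  \<open>\<sigma>\<close>-algebras (the Borel \<open>\<sigma>\<close>-algebra of the product topology). The lemmas below show
  that it is the unique translation-invariant probability on this \<open>\<sigma>\<close>-algebra.\<close>

definition Haar :: "(nat \<Rightarrow> nat) \<Rightarrow> (nat \<Rightarrow> nat) measure" where
  "Haar b = (\<Pi>\<^sub>M k\<in>{1..}. uniform_count_measure {0..<b k})"

definition phi :: "(nat \<Rightarrow> nat) \<Rightarrow> (nat \<Rightarrow> nat) \<Rightarrow> nat \<Rightarrow> nat" where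
  "phi b \<omega> = (\<lambda>n\<in>{1..}. if \<exists>k\<ge>1. [\<omega> k + n = 0] (mod b k) then 0 else 1)"

definition nu :: "(nat \<Rightarrow> nat) \<Rightarrow> (nat \<Rightarrow> nat) measure" where
  "nu b = distr (Haar b) X_algebra (phi b)"

lemma space_Haar: "space (Haar b) = (\<Pi>\<^sub>E k\<in>{1..}. {0..<b k})"
  by (simp add: Haar_def space_PiM space_uniform_count_measure)

lemma space_X_algebra: "space X_algebra = X"
  by (simp add: X_algebra_def X_def space_PiM)

lemma prob_space_Haar:
  assumes "\<And>k. k \<ge> 1 \<Longrightarrow> b k > 0"
  shows "prob_space (Haar b)"
  unfolding Haar_def
  by (rule prob_space_PiM) (use assms in \<open>auto intro!: prob_space_uniform_count_measure\<close>)

definition translate :: "(nat \<Rightarrow> nat) \<Rightarrow> (nat \<Rightarrow> nat) \<Rightarrow> (nat \<Rightarrow> nat) \<Rightarrow> nat \<Rightarrow> nat" where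
  "translate b a \<omega> = (\<lambda>k\<in>{1..}. (\<omega> k + a k) mod b k)"

lemma measurable_translate:
  assumes pos: "\<And>k. k \<ge> 1 \<Longrightarrow> b k > 0"
  shows "translate b a \<in> measurable (Haar b) (Haar b)"
  unfolding translate_def Haar_def
proof (rule measurable_restrict)
  fix k :: nat assume k: "k \<in> {1..}"
  have "(\<lambda>\<omega>. \<omega> k) \<in> measurable (\<Pi>\<^sub>M k\<in>{1..}. uniform_count_measure {0..<b k})
      (uniform_count_measure {0..<b k})"
    using k by (rule measurable_component_singleton)
  moreover have "(\<lambda>x. (x + a k) mod b k) \<in> measurable (uniform_count_measure {0..<b k})
      (uniform_count_measure {0..<b k})"
    using pos k by (auto simp: measurable_def sets_uniform_count_measure space_uniform_count_measure)
  ultimately show "(\<lambda>\<omega>. (\<omega> k + a k) mod b k) \<in> measurable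
      (\<Pi>\<^sub>M k\<in>{1..}. uniform_count_measure {0..<b k}) (uniform_count_measure {0..<b k})"
    by (rule measurable_compose)
qed

lemma bij_betw_add_mod:
  fixes m c :: nat
  assumes "m > 0"
  shows "bij_betw (\<lambda>x. (x + c) mod m) {0..<m} {0..<m}"
proof -
  have "inj_on (\<lambda>x. (x + c) mod m) {0..<m}"
  proof (rule inj_onI)
    fix x y assume x: "x \<in> {0..<m}" and y: "y \<in> {0..<m}" and eq: "(x + c) mod m = (y + c) mod m"
    from eq have "[x + c = y + c] (mod m)" by (simp add: cong_def)
    then have "[x = y] (mod m)" by (simp add: cong_add_rcancel_nat)
    then show "x = y" using x y by (simp add: cong_def)
  qed
  moreover from this have "(\<lambda>x. (x + c) mod m) ` {0..<m} = {0..<m}"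
    using assms by (intro card_subset_eq) (auto simp: card_image)
  ultimately show ?thesis by (simp add: bij_betw_def)
qed

lemma emeasure_Haar_box:
  assumes pos: "\<And>k. k \<ge> 1 \<Longrightarrow> b k > 0"
    and J: "finite J" "J \<subseteq> {1..}" and F: "\<And>j. j \<in> J \<Longrightarrow> F j \<subseteq> {0..<b j}"
  shows "emeasure (Haar b) {\<omega> \<in> space (Haar b). \<forall>j\<in>J. \<omega> j \<in> F j}
    = ennreal (\<Prod>j\<in>J. real (card (F j)) / real (b j))"
proof -
  let ?M = "\<lambda>k. if k \<in> {1..} then uniform_count_measure {0..<b k} else count_space {undefined}"
  interpret M': prob_space "?M i" for i
  proof (cases "i \<in> {1..}")
    case True
    then show "prob_space (?M i)"
      using pos[of i] prob_space_uniform_count_measure[of "{0..<b i}"] by auto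
  qed (auto intro: prob_spaceI)
  interpret product_prob_space ?M "{1..}" by unfold_locales
  have Haar: "Haar b = PiM {1..} ?M" unfolding Haar_def by (rule PiM_cong) auto
  have "emeasure (Haar b) {\<omega> \<in> space (Haar b). \<forall>j\<in>J. \<omega> j \<in> F j} = (\<Prod>j\<in>J. emeasure (?M j) (F j))"
    unfolding Haar by (rule emeasure_PiM_Collect) (use J F in \<open>auto simp: sets_uniform_count_measure\<close>)
  also have "\<dots> = (\<Prod>j\<in>J. ennreal (real (card (F j)) / real (b j)))"
  proof (rule prod.cong[OF refl])
    fix j assume j: "j \<in> J"
    then show "emeasure (?M j) (F j) = ennreal (real (card (F j)) / real (b j))"
      using F[OF j] J by (auto simp: emeasure_uniform_count_measure)
  qed
  also have "\<dots> = ennreal (\<Prod>j\<in>J. real (card (F j)) / real (b j))"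
    by (rule prod_ennreal) auto
  finally show ?thesis .
qed

lemma sets_Haar_box:
  assumes J: "finite J" "J \<subseteq> {1..}" and F: "\<And>j. j \<in> J \<Longrightarrow> F j \<subseteq> {0..<b j}"
  shows "{\<omega> \<in> space (Haar b). \<forall>j\<in>J. \<omega> j \<in> F j} \<in> sets (Haar b)"
proof (rule sets.sets_Collect_finite_All)
  fix j assume j: "j \<in> J"
  then show "{\<omega> \<in> space (Haar b). \<omega> j \<in> F j} \<in> sets (Haar b)"
  proof -
    have "(\<lambda>\<omega>. \<omega> j) \<in> measurable (Haar b) (uniform_count_measure {0..<b j})"
      unfolding Haar_def by (rule measurable_component_singleton) (use j J in auto)
    then have "(\<lambda>\<omega>. \<omega> j) -` F j \<inter> space (Haar b) \<in> sets (Haar b)"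
      by (rule measurable_sets) (use F[OF j] in \<open>auto simp: sets_uniform_count_measure\<close>)
    then show ?thesis
      by (simp add: vimage_def Int_def conj_commute)
  qed
qed (use J in auto)

lemma Haar_eqI:
  assumes pos: "\<And>k. k \<ge> 1 \<Longrightarrow> b k > 0"
    and sets: "sets P = sets (Haar b)"
    and eq: "\<And>J F. finite J \<Longrightarrow> J \<subseteq> {1..} \<Longrightarrow> (\<And>j. j \<in> J \<Longrightarrow> F j \<subseteq> {0..<b j}) \<Longrightarrow>
      emeasure P {\<omega> \<in> space (Haar b). \<forall>j\<in>J. \<omega> j \<in> F j}
        = ennreal (\<Prod>j\<in>J. real (card (F j)) / real (b j))"
  shows "P = Haar b"
proof (rule measure_eqI_PiM_infinite[where I="{1..}" and M="\<lambda>k. uniform_count_measure {0..<b k}"])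
  have em: "prod_emb {1..} (\<lambda>k. uniform_count_measure {0..<b k}) J (Pi\<^sub>E J F)
      = {\<omega> \<in> space (Haar b). \<forall>j\<in>J. \<omega> j \<in> F j}" if "J \<subseteq> {1..}" for J F
    using that by (auto simp: prod_emb_def Haar_def space_PiM PiE_def Pi_def extensional_def
      space_uniform_count_measure restrict_def)
  show "emeasure P (prod_emb {1..} (\<lambda>k. uniform_count_measure {0..<b k}) J (Pi\<^sub>E J A))
      = emeasure (Haar b) (prod_emb {1..} (\<lambda>k. uniform_count_measure {0..<b k}) J (Pi\<^sub>E J A))"
    if "finite J" "J \<subseteq> {1..}" "\<And>i. i \<in> J \<Longrightarrow> A i \<in> sets (uniform_count_measure {0..<b i})" for A J
  proof -
    have F: "\<And>j. j \<in> J \<Longrightarrow> A j \<subseteq> {0..<b j}"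
      using that by (auto simp: sets_uniform_count_measure)
    show ?thesis
      unfolding em[OF that(2)]
      by (subst eq[OF that(1,2) F], simp, subst emeasure_Haar_box[OF pos that(1,2) F]) auto
  qed
  show "finite_measure P"
  proof
    have "emeasure P {\<omega> \<in> space (Haar b). \<forall>j\<in>{}. \<omega> j \<in> {}} = 1"
      using eq[of "{}" "\<lambda>_. {}"] by simp
    then show "emeasure P (space P) \<noteq> \<infinity>"
      using sets_eq_imp_space_eq[OF sets] by simp
  qed
qed (use sets in \<open>auto simp: Haar_def\<close>)

lemma Haar_translation_invariant:
  assumes pos: "\<And>k. k \<ge> 1 \<Longrightarrow> b k > 0"
  shows "distr (Haar b) (Haar b) (translate b a) = Haar b"
proof (rule Haar_eqI[OF pos])
  fix J and F :: "nat \<Rightarrow> nat set"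
  assume J: "finite J" "J \<subseteq> {1..}" and F: "\<And>j. j \<in> J \<Longrightarrow> F j \<subseteq> {0..<b j}"
  define G where "G j = {x \<in> {0..<b j}. (x + a j) mod b j \<in> F j}" for j
  have card: "card (G j) = card (F j)" if j: "j \<in> J" for j
  proof -
    have bij: "bij_betw (\<lambda>x. (x + a j) mod b j) {0..<b j} {0..<b j}"
      using bij_betw_add_mod pos J j by auto
    have "(\<lambda>x. (x + a j) mod b j) ` G j = F j"
    proof (intro equalityI subsetI)
      fix y assume y: "y \<in> F j"
      then have "y \<in> (\<lambda>x. (x + a j) mod b j) ` {0..<b j}"
        unfolding bij_betw_imp_surj_on[OF bij] using F[OF j] by (rule_tac subsetD)
      then obtain x where "x \<in> {0..<b j}" "y = (x + a j) mod b j" by (rule imageE)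
      with y show "y \<in> (\<lambda>x. (x + a j) mod b j) ` G j" by (simp add: G_def)
    qed (auto simp: G_def)
    moreover have "inj_on (\<lambda>x. (x + a j) mod b j) (G j)"
      using bij_betw_imp_inj_on[OF bij] by (rule inj_on_subset) (auto simp: G_def)
    ultimately show ?thesis using card_image by force
  qed
  have "emeasure (distr (Haar b) (Haar b) (translate b a)) {\<omega> \<in> space (Haar b). \<forall>j\<in>J. \<omega> j \<in> F j}
      = emeasure (Haar b) (translate b a -` {\<omega> \<in> space (Haar b). \<forall>j\<in>J. \<omega> j \<in> F j} \<inter> space (Haar b))"
    by (rule emeasure_distr[OF measurable_translate[OF pos] sets_Haar_box[OF J F]])
  also have "translate b a -` {\<omega> \<in> space (Haar b). \<forall>j\<in>J. \<omega> j \<in> F j} \<inter> space (Haar b)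
      = {\<omega> \<in> space (Haar b). \<forall>j\<in>J. \<omega> j \<in> G j}"
  proof -
    have "translate b a \<omega> \<in> space (Haar b)" if "\<omega> \<in> space (Haar b)" for \<omega>
      using measurable_space[OF measurable_translate[OF pos] that] .
    moreover have "translate b a \<omega> j \<in> F j \<longleftrightarrow> \<omega> j \<in> G j" if "\<omega> \<in> space (Haar b)" "j \<in> J" for \<omega> j
      using that J by (auto simp: translate_def G_def space_Haar PiE_def Pi_def)
    ultimately show ?thesis by blast
  qed
  also have "emeasure (Haar b) \<dots> = ennreal (\<Prod>j\<in>J. real (card (G j)) / real (b j))"
    by (rule emeasure_Haar_box[OF pos J]) (auto simp: G_def)
  also have "(\<Prod>j\<in>J. real (card (G j)) / real (b j)) = (\<Prod>j\<in>J. real (card (F j)) / real (b j))"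
    by (rule prod.cong) (auto simp: card)
  finally show "emeasure (distr (Haar b) (Haar b) (translate b a))
      {\<omega> \<in> space (Haar b). \<forall>j\<in>J. \<omega> j \<in> F j} = ennreal (\<Prod>j\<in>J. real (card (F j)) / real (b j))" .
qed simp_all

lemma Haar_unique:
  assumes pos: "\<And>k. k \<ge> 1 \<Longrightarrow> b k > 0"
    and P: "prob_space P" and sets: "sets P = sets (Haar b)"
    and inv: "\<And>a. distr P P (translate b a) = P"
  shows "P = Haar b"
proof (rule Haar_eqI[OF pos sets])
  fix J and F :: "nat \<Rightarrow> nat set"
  assume J: "finite J" "J \<subseteq> {1..}" and F: "\<And>j. j \<in> J \<Longrightarrow> F j \<subseteq> {0..<b j}"
  interpret prob_space P by (rule P)
  have space: "space P = space (Haar b)" by (rule sets_eq_imp_space_eq[OF sets])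
  define cyl where "cyl c = {\<omega> \<in> space (Haar b). \<forall>j\<in>J. \<omega> j = c j}" for c :: "nat \<Rightarrow> nat"
  have cyl_sets: "cyl c \<in> events" if "c \<in> (\<Pi>\<^sub>E j\<in>J. {0..<b j})" for c
  proof -
    have "{\<omega> \<in> space (Haar b). \<forall>j\<in>J. \<omega> j \<in> {c j}} \<in> sets (Haar b)"
      by (rule sets_Haar_box[OF J]) (use PiE_mem[OF that] in simp)
    then show ?thesis by (simp add: cyl_def sets)
  qed
  have cyl_eq: "prob (cyl c) = prob (cyl (\<lambda>_. 0))" if c: "c \<in> (\<Pi>\<^sub>E j\<in>J. {0..<b j})" for c
  proof -
    have m: "translate b c \<in> measurable P P"
      unfolding measurable_cong_sets[OF sets sets] by (rule measurable_translate[OF pos])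
    have "prob (cyl c) = measure (distr P P (translate b c)) (cyl c)"
      by (simp add: inv)
    also have "\<dots> = prob (translate b c -` cyl c \<inter> space P)"
      by (rule measure_distr[OF m cyl_sets[OF c]])
    also have "translate b c -` cyl c \<inter> space P = cyl (\<lambda>_. 0)"
    proof -
      have tr: "translate b c \<omega> \<in> space (Haar b)" if "\<omega> \<in> space (Haar b)" for \<omega>
        using measurable_space[OF measurable_translate[OF pos] that] .
      have val: "translate b c \<omega> j = c j \<longleftrightarrow> \<omega> j = 0" if w: "\<omega> \<in> space (Haar b)" and j: "j \<in> J" for \<omega> j
      proof -
        have j1: "j \<in> {1..}" using J j by auto
        have lt: "\<omega> j < b j" "c j < b j"
          using w j1 PiE_mem[OF c j] by (auto simp: space_Haar PiE_def Pi_def)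
        have "(\<omega> j + c j) mod b j = c j \<longleftrightarrow> [\<omega> j + c j = 0 + c j] (mod b j)"
          using lt by (simp add: cong_def)
        also have "\<dots> \<longleftrightarrow> [\<omega> j = 0] (mod b j)" by (rule cong_add_rcancel_nat)
        also have "\<dots> \<longleftrightarrow> \<omega> j = 0" using lt by (simp add: cong_def)
        finally show ?thesis using j1 by (simp add: translate_def)
      qed
      show ?thesis
      proof (rule Set.set_eqI)
        fix \<omega>
        have "(\<forall>j\<in>J. translate b c \<omega> j = c j) \<longleftrightarrow> (\<forall>j\<in>J. \<omega> j = 0)" if "\<omega> \<in> space (Haar b)"
          using val[OF that] by (intro ball_cong) auto
        then show "\<omega> \<in> translate b c -` cyl c \<inter> space P \<longleftrightarrow> \<omega> \<in> cyl (\<lambda>_. 0)"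
          using tr[of \<omega>] by (auto simp only: cyl_def space vimage_eq Int_iff mem_Collect_eq)
      qed
    qed
    finally show ?thesis .
  qed
  have box: "prob {\<omega> \<in> space (Haar b). \<forall>j\<in>J. \<omega> j \<in> G j} = (\<Prod>j\<in>J. real (card (G j))) * prob (cyl (\<lambda>_. 0))"
    if G: "\<And>j. j \<in> J \<Longrightarrow> G j \<subseteq> {0..<b j}" for G
  proof -
    have sub: "(\<Pi>\<^sub>E j\<in>J. G j) \<subseteq> (\<Pi>\<^sub>E j\<in>J. {0..<b j})"
      using G by (rule PiE_mono)
    have fin: "finite (\<Pi>\<^sub>E j\<in>J. G j)"
      by (rule finite_PiE[OF J(1)]) (rule finite_subset[OF G finite_atLeastLessThan])
    have "{\<omega> \<in> space (Haar b). \<forall>j\<in>J. \<omega> j \<in> G j} = (\<Union>c\<in>(\<Pi>\<^sub>E j\<in>J. G j). cyl c)"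
    proof (intro equalityI subsetI)
      fix \<omega> assume w: "\<omega> \<in> {\<omega> \<in> space (Haar b). \<forall>j\<in>J. \<omega> j \<in> G j}"
      show "\<omega> \<in> (\<Union>c\<in>(\<Pi>\<^sub>E j\<in>J. G j). cyl c)"
        by (rule UN_I[of "restrict \<omega> J"]) (use w in \<open>auto simp: cyl_def\<close>)
    next
      fix \<omega> assume "\<omega> \<in> (\<Union>c\<in>(\<Pi>\<^sub>E j\<in>J. G j). cyl c)"
      then obtain c where c: "c \<in> (\<Pi>\<^sub>E j\<in>J. G j)" and w: "\<omega> \<in> cyl c" by (rule UN_E)
      show "\<omega> \<in> {\<omega> \<in> space (Haar b). \<forall>j\<in>J. \<omega> j \<in> G j}"
        using w PiE_mem[OF c] by (simp add: cyl_def)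
    qed
    also have "prob \<dots> = (\<Sum>c\<in>(\<Pi>\<^sub>E j\<in>J. G j). prob (cyl c))"
    proof (rule finite_measure_finite_Union[OF fin])
      show "cyl ` (\<Pi>\<^sub>E j\<in>J. G j) \<subseteq> events" using cyl_sets sub by blast
      show "disjoint_family_on cyl (\<Pi>\<^sub>E j\<in>J. G j)"
        unfolding disjoint_family_on_def
      proof (intro ballI impI)
        fix c d assume cd: "c \<in> (\<Pi>\<^sub>E j\<in>J. G j)" "d \<in> (\<Pi>\<^sub>E j\<in>J. G j)" "c \<noteq> d"
        then obtain j where "j \<in> J" "c j \<noteq> d j" using PiE_ext[OF cd(1,2)] by blast
        then show "cyl c \<inter> cyl d = {}" by (auto simp: cyl_def)
      qed
    qed
    also have "\<dots> = (\<Sum>c\<in>(\<Pi>\<^sub>E j\<in>J. G j). prob (cyl (\<lambda>_. 0)))"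
      by (rule sum.cong[OF refl]) (use cyl_eq sub in blast)
    also have "\<dots> = (\<Prod>j\<in>J. real (card (G j))) * prob (cyl (\<lambda>_. 0))"
      using J(1) by (simp add: card_PiE)
    finally show ?thesis .
  qed
  have "{\<omega> \<in> space (Haar b). \<forall>j\<in>J. \<omega> j \<in> {0..<b j}} = space P"
    unfolding space using J by (auto simp: space_Haar PiE_def Pi_def)
  then have one: "(\<Prod>j\<in>J. real (b j)) * prob (cyl (\<lambda>_. 0)) = 1"
    using box[of "\<lambda>j. {0..<b j}"] prob_space by simp
  then have cyl0: "prob (cyl (\<lambda>_. 0)) = 1 / (\<Prod>j\<in>J. real (b j))"
    using nonzero_mult_div_cancel_left[of "\<Prod>j\<in>J. real (b j)" "prob (cyl (\<lambda>_. 0))"] by fastforce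
  have "prob {\<omega> \<in> space (Haar b). \<forall>j\<in>J. \<omega> j \<in> F j}
      = (\<Prod>j\<in>J. real (card (F j))) * prob (cyl (\<lambda>_. 0))"
    using F by (rule box)
  also have "\<dots> = (\<Prod>j\<in>J. real (card (F j)) / real (b j))"
    unfolding cyl0 prod_dividef by simp
  finally show "emeasure P {\<omega> \<in> space (Haar b). \<forall>j\<in>J. \<omega> j \<in> F j}
      = ennreal (\<Prod>j\<in>J. real (card (F j)) / real (b j))"
    unfolding emeasure_eq_measure by (rule arg_cong)
qed

lemma phi_measurable: "phi b \<in> measurable (Haar b) X_algebra"
proof -
  have comp: "(\<lambda>\<omega>. \<omega> k) \<in> measurable (Haar b) (count_space UNIV)" if "k \<ge> 1" for k
  proof -
    have "(\<lambda>\<omega>. \<omega> k) \<in> measurable (Haar b) (uniform_count_measure {0..<b k})"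
      unfolding Haar_def by (rule measurable_component_singleton) (use that in auto)
    moreover have "(\<lambda>x. x) \<in> measurable (uniform_count_measure {0..<b k}) (count_space UNIV)"
      by (simp add: measurable_def sets_uniform_count_measure space_uniform_count_measure)
    ultimately show ?thesis
      by (rule measurable_compose)
  qed
  have pr': "Measurable.pred (Haar b) (\<lambda>\<omega>. \<exists>k\<ge>1. [\<omega> k + n = 0] (mod b k))" for n
  proof (rule pred_intros_countable(2))
    fix k :: nat
    show "Measurable.pred (Haar b) (\<lambda>\<omega>. k \<ge> 1 \<and> [\<omega> k + n = 0] (mod b k))"
    proof (cases "k \<ge> 1")
      case True
      then have "Measurable.pred (Haar b) (\<lambda>\<omega>. [\<omega> k + n = 0] (mod b k))"
        by (intro measurable_compose[OF comp[of k]]) simp_all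
      with True show ?thesis by simp
    qed simp
  qed
  show ?thesis
    unfolding X_algebra_def phi_def
  proof (rule measurable_restrict)
    fix n :: nat
    show "(\<lambda>\<omega>. if \<exists>k\<ge>1. [\<omega> k + n = 0] (mod b k) then 0 else 1)
        \<in> measurable (Haar b) (count_space {0, 1})"
      by (rule measurable_If[OF _ _ pr'[of n, unfolded pred_def]]) simp_all
  qed
qed

lemma cylinder_measurable:
  assumes "cylinder C"
  shows "C \<in> sets X_algebra"
proof -
  obtain J a where J: "finite J" "J \<subseteq> {1..}" "C = {x \<in> X. \<forall>n\<in>J. x n = a n}"
    using assms unfolding cylinder_def by blast
  have "{x \<in> space X_algebra. \<forall>n\<in>J. x n = a n} \<in> sets X_algebra"
  proof (rule sets.sets_Collect_finite_All)
    fix n assume "n \<in> J"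
    then have "n \<in> {1..}" using J by auto
    then have "(\<lambda>x. x n) \<in> measurable X_algebra (count_space {0, 1})"
      unfolding X_algebra_def by (rule measurable_component_singleton)
    then have "(\<lambda>x. x n) -` ({a n} \<inter> {0,1}) \<inter> space X_algebra \<in> sets X_algebra"
      by (rule measurable_sets) simp
    moreover have "(\<lambda>x. x n) -` ({a n} \<inter> {0,1}) \<inter> space X_algebra
        = {x \<in> space X_algebra. x n = a n}"
    proof -
      have "x n \<in> {0, 1}" if "x \<in> space X_algebra" for x
        using that \<open>n \<in> {1..}\<close> unfolding space_X_algebra X_def by (rule PiE_mem)
      then show ?thesis by blast
    qed
    ultimately show "{x \<in> space X_algebra. x n = a n} \<in> sets X_algebra"
      by simp
  qed (use J in auto)
  then show ?thesis
    using J by (simp add: space_X_algebra)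
qed

lemma measure_nu_cylinder:
  assumes "cylinder C"
  shows "measure (nu b) C = measure (Haar b) (phi b -` C \<inter> space (Haar b))"
  unfolding nu_def by (rule measure_distr[OF phi_measurable cylinder_measurable[OF assms]])

end

theory Submission
  imports Defs
begin

text \<open>Keep only finitely many moduli \<open>b\<^sub>k\<close>, \<open>k \<in> I\<close>: the truncated sequence is periodic, so its averages over
  windows of length \<open>sqrt N\<close> converge to the mean over a period, which is the Haar measure of the
  truncated event. The remaining moduli, with reciprocal sum at most \<open>\<sigma>\<close>, change that measure by
  \<open>O(\<sigma>)\<close> and divide \<open>O(\<sigma> sqrt N)\<close> elements of the window: the moduli up to \<open>C sqrt N\<close> have \<open>\<sigma> sqrt N + o(sqrt N)\<close>
  multiples there, because they have density zero, while a multiple of a larger one has a cofactor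
  below \<open>2 sqrt N / C\<close>, and each cofactor accounts for at most \<open>M\<close> moduli by hypothesis.\<close>

section \<open>Sieving short intervals\<close>

text \<open>The tail is controlled through its finite subsums, the form in which the counting
  arguments and the union bounds consume it. \<open>F\<close> is a finite set whose sum is within
  \<open>\<sigma>\<close> of the total, so any finite set disjoint from it has at most
  \<open>\<sigma>\<close> left.\<close>

lemma summable_on_small_tails:
  fixes f :: "'a \<Rightarrow> real"
  assumes "f summable_on A" "\<And>x. x \<in> A \<Longrightarrow> f x \<ge> 0" "\<sigma> > 0"
  obtains F where "finite F" "F \<subseteq> A" "\<And>G. finite G \<Longrightarrow> G \<subseteq> A - F \<Longrightarrow> sum f G \<le> \<sigma>"
proof -
  obtain F where F: "finite F" "F \<subseteq> A" "dist (sum f F) (infsum f A) \<le> \<sigma>"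
    using infsum_finite_approximation[OF assms(1,3)] by blast
  show ?thesis
  proof (rule that[OF F(1,2)])
    fix G assume G: "finite G" "G \<subseteq> A - F"
    have "sum f (F \<union> G) \<le> infsum f A"
      by (rule finite_sum_le_infsum[OF assms(1)]) (use F G assms(2) in auto)
    moreover have "sum f (F \<union> G) = sum f F + sum f G"
      by (rule sum.union_disjoint) (use F G in auto)
    ultimately show "sum f G \<le> \<sigma>" using F(3) by (simp add: dist_real_def)
  qed
qed

text \<open>A convergent reciprocal sum forces density zero. Outside a finite \<open>F\<close>, each
  \<open>m \<le> x\<close> contributes \<open>1 \<le> x / m\<close>, so these elements number at
  most \<open>x\<close> times a small tail; the fixed count of \<open>F\<close> is absorbed for
  large \<open>x\<close>.\<close>

lemma card_sublinear:
  fixes S :: "nat set"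
  assumes "S \<subseteq> {1..}" "(\<lambda>m. 1 / real m) summable_on S" "\<kappa> > 0"
  shows "eventually (\<lambda>x::real. real (card {m \<in> S. real m \<le> x}) \<le> \<kappa> * x) at_top"
proof -
  obtain F where F: "finite F" "F \<subseteq> S"
    "\<And>G. finite G \<Longrightarrow> G \<subseteq> S - F \<Longrightarrow> (\<Sum>m\<in>G. 1 / real m) \<le> \<kappa> / 2"
    using summable_on_small_tails[OF assms(2), of "\<kappa> / 2"] assms(3) by auto
  have "real (card {m \<in> S. real m \<le> x}) \<le> \<kappa> * x" if x: "x \<ge> 2 * real (card F) / \<kappa>" for x
  proof -
    have x0: "x \<ge> 0" by (rule order_trans[OF _ x]) (use assms(3) in simp)
    define G where "G = {m \<in> S - F. real m \<le> x}"
    have fin: "finite {m. real m \<le> x}"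
      by (rule finite_subset[of _ "{..nat \<lfloor>x\<rfloor>}"]) (auto simp: le_nat_floor)
    then have finG: "finite G" by (rule rev_finite_subset) (auto simp: G_def)
    have "card {m \<in> S. real m \<le> x} \<le> card (F \<union> G)"
      by (rule card_mono) (use F finG in \<open>auto simp: G_def\<close>)
    also have "\<dots> \<le> card F + card G" by (rule card_Un_le)
    finally have 1: "real (card {m \<in> S. real m \<le> x}) \<le> real (card F) + real (card G)" by linarith
    have "real (card G) = (\<Sum>m\<in>G. 1)" by simp
    also have "\<dots> \<le> (\<Sum>m\<in>G. x * (1 / real m))"
      by (rule sum_mono) (use assms(1) in \<open>auto simp: G_def field_simps\<close>)
    also have "\<dots> = x * (\<Sum>m\<in>G. 1 / real m)" by (simp add: sum_distrib_left)
    also have "\<dots> \<le> x * (\<kappa> / 2)"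
      by (rule mult_left_mono[OF F(3) x0]) (use finG in \<open>auto simp: G_def\<close>)
    finally have 2: "real (card G) \<le> x * (\<kappa> / 2)" .
    have "real (card F) \<le> x * (\<kappa> / 2)" using x assms(3) by (simp add: field_simps)
    with 1 2 show ?thesis by (simp add: field_simps)
  qed
  then show ?thesis unfolding eventually_at_top_linorder by blast
qed

lemma card_multiples_le:
  fixes m N L :: nat
  assumes "m > 0"
  shows "real (card {n \<in> {N..<N+L}. m dvd n}) \<le> real L / real m + 2"
proof -
  have "inj_on (\<lambda>n. n div m) {n \<in> {N..<N+L}. m dvd n}"
    by (rule inj_onI) (use assms in \<open>auto elim!: dvdE\<close>)
  \<comment> \<open>The quotient range includes its upper end although \<open>N + L\<close> itself
    is excluded. This and the rounding down of \<open>N / m\<close> cost at most 1 each, whence the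
    2 in the bound.\<close>
  then have "card {n \<in> {N..<N+L}. m dvd n} \<le> card {N div m..(N + L) div m}"
    by (rule card_inj_on_le) (auto intro!: div_le_mono)
  then have "real (card {n \<in> {N..<N+L}. m dvd n}) \<le> real ((N + L) div m) + 1 - real (N div m)"
    using div_le_mono[of N "N + L" m] by simp
  moreover have "real ((N + L) div m) \<le> (real N + real L) / real m"
    using of_nat_div_le_of_nat[of "N + L" m] by simp
  moreover have "real N / real m < real (N div m) + 1"
  proof -
    have "N < (N div m + 1) * m"
      using assms by (metis Suc_eq_plus1 dividend_less_div_times mult_Suc add.commute)
    then have "real N < (real (N div m) + 1) * real m"
      by (metis of_nat_1 of_nat_add of_nat_less_iff of_nat_mult)
    then show ?thesis using assms by (simp add: field_simps)
  qed
  ultimately show ?thesis by (simp add: add_divide_distrib)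
qed

definition window :: "nat \<Rightarrow> nat set" where
  "window N = {n. N \<le> n \<and> real n < real N + sqrt (real N)}"

lemma window_eq: "window N = {N..<N + nat \<lceil>sqrt (real N)\<rceil>}"
proof -
  have "real n < real N + sqrt (real N) \<longleftrightarrow> n < N + nat \<lceil>sqrt (real N)\<rceil>" if "N \<le> n" for n
  proof -
    have "real n < real N + sqrt (real N) \<longleftrightarrow> real (n - N) < sqrt (real N)"
      using that by (auto simp: of_nat_diff)
    also have "\<dots> \<longleftrightarrow> n - N < nat \<lceil>sqrt (real N)\<rceil>"
      by (simp add: zless_nat_eq_int_zless less_ceiling_iff)
    finally show ?thesis using that by linarith
  qed
  then show ?thesis by (auto simp: window_def)
qed

lemma finite_window [simp]: "finite (window N)"
  by (simp add: window_eq)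

text \<open>A number of the window divisible by some \<open>m > 2 sqrt N / \<delta>\<close> has cofactor \<open>q \<le> \<delta> sqrt N\<close>, and
  the possible \<open>m\<close> for a given \<open>q\<close> lie in an interval \<open>[x, x + sqrt x]\<close> with \<open>x = N / q\<close>.\<close>

lemma card_large_divisor:
  fixes B :: "nat set" and M :: nat
  assumes M: "\<And>x. x \<ge> x0 \<Longrightarrow> card {m \<in> B. x \<le> real m \<and> real m \<le> x + sqrt x} \<le> M"
    and \<delta>: "\<delta> > 0" and N: "N > 0" "sqrt (real N) / \<delta> \<ge> x0"
  shows "real (card {n \<in> window N. \<exists>m\<in>B. real m > 2 * sqrt (real N) / \<delta> \<and> m dvd n})
    \<le> real M * (\<delta> * sqrt (real N))"
proof -
  define s where "s = sqrt (real N)"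
  have s: "s \<ge> 1" "s * s = real N" using N by (auto simp: s_def)
  define Q where "Q = {q::nat. 1 \<le> q \<and> real q \<le> \<delta> * s}"
  define A where "A q = {m \<in> B. real N / real q \<le> real m \<and> real m \<le> real N / real q + sqrt (real N / real q)}"
    for q :: nat
  have Qsub: "Q \<subseteq> {1..nat \<lfloor>\<delta> * s\<rfloor>}" by (auto simp: Q_def le_nat_floor)
  have finA: "finite (A q)" for q
    by (rule finite_subset[of _ "{..nat \<lfloor>real N / real q + sqrt (real N / real q)\<rfloor>}"])
       (auto simp: A_def le_nat_floor)
  have finQ: "finite Q" using Qsub by (rule finite_subset) simp
  have "{n \<in> window N. \<exists>m\<in>B. real m > 2 * s / \<delta> \<and> m dvd n} \<subseteq> (\<Union>q\<in>Q. (\<lambda>m. m * q) ` A q)"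
  proof
    fix n assume "n \<in> {n \<in> window N. \<exists>m\<in>B. real m > 2 * s / \<delta> \<and> m dvd n}"
    then obtain m q where n: "n = m * q" "m \<in> B" "real m > 2 * s / \<delta>"
      "N \<le> n" "real n < real N + s"
      by (auto simp: window_def s_def elim!: dvdE)
    have q: "q \<ge> 1" "m \<ge> 1" using n N by (auto simp: Suc_le_eq intro!: Nat.gr0I)
    have mq: "real m * real q < s * s + s" "s * s \<le> real m * real q"
      using n s(2) by (auto simp flip: of_nat_mult)
    \<comment> \<open>Since \<open>s \<ge> 1\<close>, the product \<open>m * q\<close> is at most
      \<open>2 * s * s\<close>; the factor 2 in the threshold for \<open>m\<close> cancels this
      2.\<close>
    have "2 * s / \<delta> * real q \<le> real m * real q" using n(3) by (intro mult_right_mono) auto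
    also have "\<dots> \<le> 2 * (s * s)" using mq s mult_left_mono[of 1 s s] by linarith
    finally have "s * real q \<le> s * (\<delta> * s)" using \<delta> by (simp add: field_simps)
    then have "real q \<le> \<delta> * s" using s by (simp add: mult_le_cancel_left)
    then have qQ: "q \<in> Q" using q by (simp add: Q_def)
    \<comment> \<open>For fixed \<open>q\<close> the modulus \<open>m\<close> ranges over an
      interval of length \<open>s / q\<close> starting at \<open>N / q\<close>. As
      \<open>sqrt q \<le> q\<close>, this length is at most \<open>sqrt (N / q)\<close>, so the
      hypothesis with \<open>x = N / q\<close> covers the interval.\<close>
    have "sqrt (real q) \<le> real q"
      by (rule real_le_lsqrt) (use q in \<open>auto simp: power2_eq_square\<close>)
    then have "s / real q \<le> s / sqrt (real q)"
      using q s by (intro divide_left_mono) auto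
    also have "\<dots> = sqrt (real N / real q)" by (simp add: s_def real_sqrt_divide)
    finally have "(s * s + s) / real q \<le> real N / real q + sqrt (real N / real q)"
      using s by (simp add: add_divide_distrib)
    moreover have "real m \<le> (s * s + s) / real q" using mq q by (simp add: field_simps)
    moreover have "real N / real q \<le> real m" using mq q s by (simp add: field_simps)
    ultimately have "m \<in> A q" using n by (simp add: A_def)
    then show "n \<in> (\<Union>q\<in>Q. (\<lambda>m. m * q) ` A q)" using n(1) qQ by blast
  qed
  then have "card {n \<in> window N. \<exists>m\<in>B. real m > 2 * s / \<delta> \<and> m dvd n} \<le> card (\<Union>q\<in>Q. (\<lambda>m. m * q) ` A q)"
    by (rule card_mono[rotated]) (use finQ finA in auto)
  also have "\<dots> \<le> (\<Sum>q\<in>Q. card ((\<lambda>m. m * q) ` A q))" by (rule card_UN_le[OF finQ])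
  also have "\<dots> \<le> (\<Sum>q\<in>Q. M)"
  proof (rule sum_mono)
    fix q assume q: "q \<in> Q"
    \<comment> \<open>The bound on \<open>q\<close> keeps \<open>N / q\<close> above
      \<open>s / \<delta>\<close>, hence above \<open>x0\<close>, so the same \<open>M\<close>
      serves every cofactor in \<open>Q\<close>.\<close>
    have "s / \<delta> * real q \<le> s / \<delta> * (\<delta> * s)" using q s \<delta> by (intro mult_left_mono) (auto simp: Q_def)
    also have "s / \<delta> * (\<delta> * s) = real N" using s \<delta> by simp
    finally have "s / \<delta> \<le> real N / real q" using q by (simp add: Q_def pos_le_divide_eq)
    then have "x0 \<le> real N / real q" using N(2) by (simp add: s_def)
    then have "card (A q) \<le> M" unfolding A_def by (rule M)
    then show "card ((\<lambda>m. m * q) ` A q) \<le> M" using card_image_le[OF finA] order_trans by blast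
  qed
  also have "\<dots> = M * card Q" by simp
  finally have "real (card {n \<in> window N. \<exists>m\<in>B. real m > 2 * s / \<delta> \<and> m dvd n}) \<le> real M * real (card Q)"
    by (simp flip: of_nat_mult)
  also have "real (card Q) \<le> \<delta> * s"
  proof -
    have "card Q \<le> card {1..nat \<lfloor>\<delta> * s\<rfloor>}" by (rule card_mono[OF _ Qsub]) simp
    then show ?thesis using \<delta> s by (simp add: le_nat_iff le_floor_iff)
  qed
  then have "real M * real (card Q) \<le> real M * (\<delta> * s)" by (rule mult_left_mono) simp
  finally show ?thesis by (simp add: s_def)
qed

text \<open>The constant 5 is 2 + 2 + 1. Members of \<open>D\<close> up to \<open>T N\<close> cost
  \<open>2 * \<sigma> * s\<close> through the main terms \<open>L / m\<close>, because
  \<open>L \<le> 2 * s\<close>, and another \<open>2 * \<sigma> * s\<close> through the rounding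
  errors, because few elements of \<open>B\<close> lie below \<open>T N\<close>. The larger members
  cost \<open>\<sigma> * s\<close>.\<close>

lemma card_window_multiples:
  fixes B D :: "nat set" and M :: nat
  assumes B: "B \<subseteq> {1..}" "(\<lambda>m. 1 / real m) summable_on B"
    and M: "eventually (\<lambda>x::real. card {m \<in> B. x \<le> real m \<and> real m \<le> x + sqrt x} \<le> M) at_top"
    and \<sigma>: "\<sigma> > 0"
    and D: "D \<subseteq> B" "\<And>G. finite G \<Longrightarrow> G \<subseteq> D \<Longrightarrow> (\<Sum>m\<in>G. 1 / real m) \<le> \<sigma>"
  shows "eventually (\<lambda>N. real (card {n \<in> window N. \<exists>m\<in>D. m dvd n}) \<le> 5 * \<sigma> * sqrt (real N)) sequentially"
proof -
  \<comment> \<open>This makes \<open>M * \<delta> \<le> \<sigma>\<close>; the added 1 avoids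
    division by zero when \<open>M = 0\<close>.\<close>
  define \<delta> where "\<delta> = \<sigma> / (real M + 1)"
  have \<delta>: "\<delta> > 0" "real M * \<delta> \<le> \<sigma>" using \<sigma> by (auto simp: \<delta>_def field_simps)
  define T where "T N = 2 * sqrt (real N) / \<delta>" for N :: nat
  obtain x0 where x0: "\<And>x. x \<ge> x0 \<Longrightarrow> card {m \<in> B. x \<le> real m \<and> real m \<le> x + sqrt x} \<le> M"
    using M by (auto simp: eventually_at_top_linorder)
  have sq: "filterlim (\<lambda>N. sqrt (real N)) at_top sequentially"
    by (rule filterlim_compose[OF sqrt_at_top filterlim_real_sequentially])
  have lim: "filterlim (\<lambda>N. sqrt (real N) / \<delta>) at_top sequentially"
    by (rule filterlim_at_top_mult_tendsto_pos[OF tendsto_const[of "1 / \<delta>"] _ sq, simplified]) (use \<delta> in simp)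
  have "filterlim T at_top sequentially"
    using filterlim_tendsto_pos_mult_at_top[OF tendsto_const[of 2] _ lim] by (simp add: T_def[abs_def])
  \<comment> \<open>The density constant is chosen so that
    \<open>(\<sigma> * \<delta> / 2) * T N\<close> equals \<open>\<sigma> * sqrt N\<close>.\<close>
  then have ev1: "eventually (\<lambda>N. real (card {m \<in> B. real m \<le> T N}) \<le> (\<sigma> * \<delta> / 2) * T N) sequentially"
    using card_sublinear[OF B, of "\<sigma> * \<delta> / 2"] \<sigma> \<delta> by (auto intro: eventually_compose_filterlim)
  have ev2: "eventually (\<lambda>N. sqrt (real N) / \<delta> \<ge> x0) sequentially"
    using lim by (simp add: filterlim_at_top)
  show ?thesis
    using ev1 ev2 eventually_gt_at_top[of 0]
  proof eventually_elim
    case (elim N)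
    define s where "s = sqrt (real N)"
    have s: "s \<ge> 1" using elim(3) by (simp add: s_def)
    define L where "L = nat \<lceil>s\<rceil>"
    have L: "real L \<le> 2 * s" using s by (simp add: L_def) linarith
    define G where "G = {m \<in> D. real m \<le> T N}"
    have fin: "finite {m. real m \<le> T N}"
      by (rule finite_subset[of _ "{..nat \<lfloor>T N\<rfloor>}"]) (auto simp: le_nat_floor)
    have finG: "finite G" using fin by (rule rev_finite_subset) (auto simp: G_def)
    \<comment> \<open>The large moduli range over all of \<open>B\<close>: the smallness of
      \<open>U\<close> comes from \<open>\<delta>\<close>, not from the tail bound on
      \<open>D\<close>.\<close>
    define U where "U = {n \<in> window N. \<exists>m\<in>B. real m > T N \<and> m dvd n}"
    have "{n \<in> window N. \<exists>m\<in>D. m dvd n} \<subseteq> (\<Union>m\<in>G. {n \<in> window N. m dvd n}) \<union> U"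
      using D(1) by (force simp: G_def U_def not_le)
    then have "card {n \<in> window N. \<exists>m\<in>D. m dvd n} \<le> card ((\<Union>m\<in>G. {n \<in> window N. m dvd n}) \<union> U)"
      by (rule card_mono[rotated]) (use finG in \<open>auto simp: U_def\<close>)
    also have "\<dots> \<le> card (\<Union>m\<in>G. {n \<in> window N. m dvd n}) + card U" by (rule card_Un_le)
    also have "card (\<Union>m\<in>G. {n \<in> window N. m dvd n}) \<le> (\<Sum>m\<in>G. card {n \<in> window N. m dvd n})"
      by (rule card_UN_le[OF finG])
    finally have 1: "real (card {n \<in> window N. \<exists>m\<in>D. m dvd n})
        \<le> (\<Sum>m\<in>G. real (card {n \<in> window N. m dvd n})) + real (card U)"
      by (simp flip: of_nat_sum of_nat_add)
    have 2: "real (card U) \<le> real M * (\<delta> * s)"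
      unfolding U_def T_def s_def by (rule card_large_divisor[OF x0 \<delta>(1) elim(3,2)])
    have "real M * (\<delta> * s) = real M * \<delta> * s" by simp
    also have "\<dots> \<le> \<sigma> * s" by (rule mult_right_mono[OF \<delta>(2)]) (use s in simp)
    finally have 3: "real (card U) \<le> \<sigma> * s" using 2 by simp
    have "(\<Sum>m\<in>G. real (card {n \<in> window N. m dvd n})) \<le> (\<Sum>m\<in>G. real L * (1 / real m) + 2)"
    proof (rule sum_mono)
      fix m assume "m \<in> G"
      then have "m > 0" using D(1) B(1) by (auto simp: G_def)
      from card_multiples_le[OF this, of N L]
      show "real (card {n \<in> window N. m dvd n}) \<le> real L * (1 / real m) + 2"
        by (simp add: window_eq L_def s_def)
    qed
    also have "\<dots> = real L * (\<Sum>m\<in>G. 1 / real m) + 2 * real (card G)"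
      by (simp add: sum.distrib sum_distrib_left)
    also have "\<dots> \<le> real L * \<sigma> + 2 * real (card {m \<in> B. real m \<le> T N})"
    proof (intro add_mono mult_left_mono D(2) finG)
      show "real (card G) \<le> real (card {m \<in> B. real m \<le> T N})"
        using D(1) by (intro of_nat_mono card_mono finite_subset[OF _ fin]) (auto simp: G_def)
    qed (auto simp: G_def)
    also have "\<dots> \<le> (2 * s) * \<sigma> + 2 * (\<sigma> * s)"
    proof (intro add_mono mult_right_mono L mult_left_mono)
      show "real (card {m \<in> B. real m \<le> T N}) \<le> \<sigma> * s"
        using elim(1) \<delta>(1) by (simp add: T_def s_def)
    qed (use \<sigma> in auto)
    finally show ?case using 1 3 by (simp add: s_def algebra_simps)
  qed
qed

section \<open>Periodic functions on short intervals\<close>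

text \<open>Induction on the shift: advancing by one drops \<open>f c\<close> and adds
  \<open>f (c + P)\<close>, which are equal.\<close>

lemma sum_period:
  fixes f :: "nat \<Rightarrow> real"
  assumes "\<And>n. f (n + P) = f n"
  shows "(\<Sum>n<P. f (n + c)) = (\<Sum>n<P. f n)"
proof (induction c)
  case (Suc c)
  have "(\<Sum>n<P. f (n + Suc c)) + f c = (\<Sum>n<Suc P. f (n + c))"
    by (subst sum.lessThan_Suc_shift) simp
  also have "\<dots> = (\<Sum>n<P. f (n + c)) + f c" using assms[of c] by (simp add: add.commute)
  finally show ?case using Suc by simp
qed simp

text \<open>Full periods are peeled off the front, each contributing exactly \<open>P\<close> times
  the mean. What remains is shorter than \<open>P\<close>, so its sum and the expected value both
  lie between 0 and \<open>P\<close>.\<close>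

lemma sum_interval_periodic:
  fixes f :: "nat \<Rightarrow> real"
  assumes per: "\<And>n. f (n + P) = f n" and P: "P > 0" and f: "\<And>n. 0 \<le> f n" "\<And>n. f n \<le> 1"
  shows "\<bar>(\<Sum>n\<in>{N..<N+L}. f n) - real L * ((\<Sum>n<P. f n) / real P)\<bar> \<le> real P"
proof (induction L arbitrary: N rule: less_induct)
  case (less L)
  define A where "A = (\<Sum>n<P. f n) / real P"
  have A: "0 \<le> A" "A \<le> 1"
    using P f sum_mono[of "{..<P}" f "\<lambda>_. 1"] by (auto simp: A_def sum_nonneg field_simps)
  show ?case
  proof (cases "L < P")
    case True
    have "0 \<le> (\<Sum>n\<in>{N..<N+L}. f n)" "(\<Sum>n\<in>{N..<N+L}. f n) \<le> real L"
      using f sum_mono[of "{N..<N+L}" f "\<lambda>_. 1"] by (auto simp: sum_nonneg)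
    moreover have "0 \<le> real L * A" "real L * A \<le> real L"
      using A by (auto simp: mult_left_le)
    ultimately show ?thesis using True unfolding A_def by linarith
  next
    case False
    have "(\<Sum>n\<in>{N..<N+L}. f n) = (\<Sum>n\<in>{N..<N+P}. f n) + (\<Sum>n\<in>{N+P..<N+P+(L-P)}. f n)"
      using False sum.atLeastLessThan_concat[of N "N+P" "N+L" f] by simp
    also have "(\<Sum>n\<in>{N..<N+P}. f n) = (\<Sum>n<P. f (n + N))"
      using sum.shift_bounds_nat_ivl[of f 0 N P] by (simp add: add.commute lessThan_atLeast0)
    also have "\<dots> = real P * A" using P sum_period[of f P N, OF per] by (simp add: A_def)
    finally have "(\<Sum>n\<in>{N..<N+L}. f n) - real L * A
        = (\<Sum>n\<in>{N+P..<N+P+(L-P)}. f n) - real (L - P) * A"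
      using False by (simp add: of_nat_diff algebra_simps)
    moreover have "L - P < L" using False P by simp
    ultimately show ?thesis using less.IH[of "L - P" "N + P"] unfolding A_def by simp
  qed
qed

lemma window_average_periodic:
  fixes f :: "nat \<Rightarrow> real"
  assumes per: "\<And>n. f (n + P) = f n" and P: "P > 0" and f: "\<And>n. 0 \<le> f n" "\<And>n. f n \<le> 1"
  shows "(\<lambda>N. 1 / sqrt (real N) * (\<Sum>n\<in>window N. f n)) \<longlonglongrightarrow> (\<Sum>n<P. f n) / real P"
proof -
  define A where "A = (\<Sum>n<P. f n) / real P"
  have A: "0 \<le> A" "A \<le> 1"
    using P f sum_mono[of "{..<P}" f "\<lambda>_. 1"] by (auto simp: A_def sum_nonneg field_simps)
  have sq: "filterlim (\<lambda>N. sqrt (real N)) at_top sequentially"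
    by (rule filterlim_compose[OF sqrt_at_top filterlim_real_sequentially])
  \<comment> \<open>The error \<open>P + 1\<close> consists of \<open>P\<close> for the incomplete
    period and 1 for replacing the integer length of the window by \<open>sqrt N\<close>, the mean
    being at most 1.\<close>
  have lim: "(\<lambda>N. (real P + 1) / sqrt (real N)) \<longlonglongrightarrow> 0"
    by (rule real_tendsto_divide_at_top[OF tendsto_const sq])
  have "(\<lambda>N. 1 / sqrt (real N) * (\<Sum>n\<in>window N. f n) - A) \<longlonglongrightarrow> 0"
  proof (rule Lim_null_comparison[OF _ lim])
    show "eventually (\<lambda>N. norm (1 / sqrt (real N) * (\<Sum>n\<in>window N. f n) - A)
        \<le> (real P + 1) / sqrt (real N)) sequentially"
      using eventually_gt_at_top[of 0]
    proof eventually_elim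
      case (elim N)
      define s where "s = sqrt (real N)"
      have s: "s > 0" using elim by (simp add: s_def)
      define L where "L = nat \<lceil>s\<rceil>"
      have L: "s \<le> real L" "real L \<le> s + 1" using s unfolding L_def by linarith+
      have 1: "\<bar>(\<Sum>n\<in>window N. f n) - real L * A\<bar> \<le> real P"
        using sum_interval_periodic[of f P N L] assms by (simp add: A_def L_def s_def window_eq)
      have "0 \<le> (real L - s) * A" "(real L - s) * A \<le> 1"
        using L A mult_mono[of "real L - s" 1 A 1] by auto
      with 1 have 2: "\<bar>(\<Sum>n\<in>window N. f n) - s * A\<bar> \<le> real P + 1"
        by (simp add: algebra_simps)
      have "1 / s * (\<Sum>n\<in>window N. f n) - A = ((\<Sum>n\<in>window N. f n) - s * A) / s"
        using s by (simp add: field_simps)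
      then have "norm (1 / s * (\<Sum>n\<in>window N. f n) - A) = \<bar>(\<Sum>n\<in>window N. f n) - s * A\<bar> / s"
        using s by simp
      also have "\<dots> \<le> (real P + 1) / s" using 2 s by (intro divide_right_mono) auto
      finally show ?case by (simp add: s_def)
    qed
  qed
  then show ?thesis unfolding A_def by (simp add: LIM_zero_iff)
qed

section \<open>The truncated system\<close>

text \<open>One predicate serves both sides of the theorem. With \<open>I = {1..}\<close> it
  describes the zeros of \<open>phi b \<omega>\<close>, and those of \<open>eta b\<close> when
  \<open>\<omega>\<close> is constantly 0; smaller sets \<open>I\<close> give the
  truncations.\<close>

definition hits :: "(nat \<Rightarrow> nat) \<Rightarrow> nat set \<Rightarrow> (nat \<Rightarrow> nat) \<Rightarrow> nat \<Rightarrow> bool" where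
  "hits b I \<omega> n \<longleftrightarrow> (\<exists>k\<in>I. [\<omega> k + n = 0] (mod b k))"

text \<open>The offset \<open>n\<close> is the number of shifts applied. A cylinder prescribes only
  the values 0 and 1, so comparing with \<open>a j = 0\<close> determines each coordinate.\<close>

definition pattern ::
    "(nat \<Rightarrow> nat) \<Rightarrow> nat set \<Rightarrow> nat set \<Rightarrow> (nat \<Rightarrow> nat) \<Rightarrow> (nat \<Rightarrow> nat) \<Rightarrow> nat \<Rightarrow> bool" where
  "pattern b I J a \<omega> n \<longleftrightarrow> (\<forall>j\<in>J. hits b I \<omega> (n + j) \<longleftrightarrow> a j = 0)"

lemma pattern_cong:
  assumes "\<And>j. j \<in> J \<Longrightarrow> hits b I \<omega> (n + j) \<longleftrightarrow> hits b I' \<omega>' (n' + j)"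
  shows "pattern b I J a \<omega> n \<longleftrightarrow> pattern b I' J a \<omega>' n'"
  using assms by (auto simp: pattern_def)

section \<open>Cylinder membership in terms of congruences\<close>

lemma shift_funpow_apply: "j \<ge> 1 \<Longrightarrow> (shift ^^ n) x j = x (n + j)"
  by (induction n arbitrary: j) (auto simp: shift_def)

lemma shift_funpow_in_X: "x \<in> X \<Longrightarrow> (shift ^^ n) x \<in> X"
proof (induction n)
  case (Suc n)
  define y where "y = (shift ^^ n) x"
  have y: "y m \<in> {0, 1}" if "m \<ge> 1" for m
    using Suc that by (auto simp: X_def y_def dest!: PiE_mem[of _ _ _ m])
  have "shift y \<in> X"
    unfolding X_def shift_def by (rule restrict_PiE_iff[THEN iffD2]) (use y in simp)
  then show ?case by (simp add: y_def)
qed simp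

lemma eta_in_X: "eta b \<in> X"
  by (auto simp: eta_def X_def)

lemma phi_in_X: "phi b \<omega> \<in> X"
  by (auto simp: phi_def X_def)

lemma if_0_1_eq_iff:
  fixes v :: nat
  assumes "v \<in> {0, 1}"
  shows "(if h then 0 else 1) = v \<longleftrightarrow> (h \<longleftrightarrow> v = 0)"
  using assms by auto

lemma phi_apply: "j \<ge> 1 \<Longrightarrow> phi b \<omega> j = (if hits b {1..} \<omega> j then 0 else 1)"
  by (simp add: phi_def hits_def Bex_def)

lemma eta_apply: "j \<ge> 1 \<Longrightarrow> eta b j = (if hits b {1..} (\<lambda>_. 0) j then 0 else 1)"
  by (simp add: eta_def hits_def Bex_def cong_0_iff)

lemma shift_eta_in_cylinder_iff:
  assumes "J \<subseteq> {1..}" "a \<in> J \<rightarrow> {0, 1}"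
  shows "(shift ^^ n) (eta b) \<in> {x \<in> X. \<forall>j\<in>J. x j = a j} \<longleftrightarrow> pattern b {1..} J a (\<lambda>_. 0) n"
proof -
  have "(shift ^^ n) (eta b) j = a j \<longleftrightarrow> (hits b {1..} (\<lambda>_. 0) (n + j) \<longleftrightarrow> a j = 0)" if "j \<in> J" for j
  proof -
    have "a j \<in> {0, 1}" "j \<ge> 1" using that assms by auto
    moreover from this have "(shift ^^ n) (eta b) j = (if hits b {1..} (\<lambda>_. 0) (n + j) then 0 else 1)"
      by (simp only: shift_funpow_apply eta_apply trans_le_add2)
    ultimately show ?thesis by (simp only: if_0_1_eq_iff)
  qed
  then show ?thesis
    using shift_funpow_in_X[OF eta_in_X] by (simp add: pattern_def)
qed

lemma phi_in_cylinder_iff: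
  assumes "J \<subseteq> {1..}" "a \<in> J \<rightarrow> {0, 1}"
  shows "phi b \<omega> \<in> {x \<in> X. \<forall>j\<in>J. x j = a j} \<longleftrightarrow> pattern b {1..} J a \<omega> 0"
proof -
  have "phi b \<omega> j = a j \<longleftrightarrow> (hits b {1..} \<omega> (0 + j) \<longleftrightarrow> a j = 0)" if "j \<in> J" for j
  proof -
    have "a j \<in> {0, 1}" "j \<ge> 1" using that assms by auto
    then show ?thesis by (simp only: phi_apply if_0_1_eq_iff add_0)
  qed
  then show ?thesis
    using phi_in_X by (simp add: pattern_def)
qed

text \<open>This isolates the truncation error: the pattern can change only where a discarded
  modulus hits one of the finitely many coordinates. It is applied both along the orbit of 0 and to
  points of the Haar space.\<close>

lemma pattern_truncate:
  assumes "I \<subseteq> K" "\<And>j. j \<in> J \<Longrightarrow> \<not> hits b (K - I) \<omega> (n + j)"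
  shows "pattern b K J a \<omega> n \<longleftrightarrow> pattern b I J a \<omega> n"
  by (rule pattern_cong) (use assms in \<open>auto simp: hits_def\<close>)

section \<open>Haar measure of hits and of truncated patterns\<close>

lemma sets_Haar_residue:
  assumes "k \<ge> 1"
  shows "{\<omega> \<in> space (Haar b). [\<omega> k + n = 0] (mod b k)} \<in> sets (Haar b)"
proof -
  have "{\<omega> \<in> space (Haar b). \<forall>i\<in>{k}. \<omega> i \<in> {x \<in> {0..<b i}. [x + n = 0] (mod b i)}} \<in> sets (Haar b)"
    by (rule sets_Haar_box) (use assms in auto)
  also have "{\<omega> \<in> space (Haar b). \<forall>i\<in>{k}. \<omega> i \<in> {x \<in> {0..<b i}. [x + n = 0] (mod b i)}}
      = {\<omega> \<in> space (Haar b). [\<omega> k + n = 0] (mod b k)}"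
    using assms by (auto simp: space_Haar PiE_def Pi_def)
  finally show ?thesis .
qed

lemma measure_Haar_residue_le:
  assumes pos: "\<And>k. k \<ge> 1 \<Longrightarrow> b k > 0" and k: "k \<ge> 1"
  shows "measure (Haar b) {\<omega> \<in> space (Haar b). [\<omega> k + n = 0] (mod b k)} \<le> 1 / real (b k)"
proof -
  define F where "F i = {x \<in> {0..<b i}. [x + n = 0] (mod b i)}" for i
  have "{\<omega> \<in> space (Haar b). [\<omega> k + n = 0] (mod b k)} = {\<omega> \<in> space (Haar b). \<forall>i\<in>{k}. \<omega> i \<in> F i}"
    using k by (auto simp: F_def space_Haar PiE_def Pi_def)
  moreover have "emeasure (Haar b) {\<omega> \<in> space (Haar b). \<forall>i\<in>{k}. \<omega> i \<in> F i}
      = ennreal (\<Prod>i\<in>{k}. real (card (F i)) / real (b i))"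
    by (rule emeasure_Haar_box[OF pos]) (use k in \<open>auto simp: F_def\<close>)
  ultimately have "measure (Haar b) {\<omega> \<in> space (Haar b). [\<omega> k + n = 0] (mod b k)}
      = real (card (F k)) / real (b k)"
    by (simp add: measure_def)
  moreover have "card (F k) \<le> 1"
  proof -
    have "x = y" if "x \<in> F k" "y \<in> F k" for x y
    proof -
      have "[x + n = y + n] (mod b k)" using that by (auto simp: F_def cong_def)
      then have "[x = y] (mod b k)" by (simp add: cong_add_rcancel_nat)
      then show ?thesis using that by (simp add: F_def cong_def)
    qed
    moreover have "finite (F k)" by (simp add: F_def)
    ultimately show ?thesis by (simp add: card_le_Suc0_iff_eq)
  qed
  ultimately show ?thesis by (simp add: divide_right_mono)
qed

lemma sets_Haar_hits:
  assumes "I \<subseteq> {1..}"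
  shows "{\<omega> \<in> space (Haar b). hits b I \<omega> n} \<in> sets (Haar b)"
proof -
  have "{\<omega> \<in> space (Haar b). hits b I \<omega> n}
      = (\<Union>k\<in>I. {\<omega> \<in> space (Haar b). [\<omega> k + n = 0] (mod b k)})"
    by (auto simp: hits_def)
  also have "\<dots> \<in> sets (Haar b)"
    by (rule sets.countable_UN') (use assms sets_Haar_residue in auto)
  finally show ?thesis .
qed

lemma measure_Haar_hits_le:
  assumes pos: "\<And>k. k \<ge> 1 \<Longrightarrow> b k > 0" and I: "I \<subseteq> {1..}"
    and \<sigma>: "\<And>G. finite G \<Longrightarrow> G \<subseteq> I \<Longrightarrow> (\<Sum>k\<in>G. 1 / real (b k)) \<le> \<sigma>"
  shows "measure (Haar b) {\<omega> \<in> space (Haar b). hits b I \<omega> n} \<le> \<sigma>"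
proof -
  interpret prob_space "Haar b" by (rule prob_space_Haar[OF pos])
  \<comment> \<open>Padding with empty sets and zero terms outside \<open>I\<close> turns the union
    into a sequence over all naturals. The finite bounds by \<open>\<sigma>\<close> then give the
    summability that countable subadditivity requires.\<close>
  define A where "A k = (if k \<in> I then {\<omega> \<in> space (Haar b). [\<omega> k + n = 0] (mod b k)} else {})" for k
  define g where "g k = (if k \<in> I then 1 / real (b k) else 0)" for k
  have A: "A k \<in> events" for k using I sets_Haar_residue by (auto simp: A_def)
  have Ag: "prob (A k) \<le> g k" for k
    using I measure_Haar_residue_le[of b, OF pos] by (auto simp: A_def g_def)
  have partial: "sum g {..<m} \<le> \<sigma>" for m
  proof -
    have "sum g {..<m} = (\<Sum>k\<in>{..<m} \<inter> I. 1 / real (b k))"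
      by (simp add: g_def sum.inter_restrict)
    then show ?thesis using \<sigma>[of "{..<m} \<inter> I"] by simp
  qed
  have g: "summable g" by (rule summableI_nonneg_bounded[OF _ partial]) (simp add: g_def)
  have PA: "summable (\<lambda>k. prob (A k))"
    by (rule summable_comparison_test'[OF g]) (use Ag in simp)
  have "{\<omega> \<in> space (Haar b). hits b I \<omega> n} = (\<Union>k. A k)"
    by (auto simp: hits_def A_def)
  also have "prob (\<Union>k. A k) \<le> (\<Sum>k. prob (A k))"
    by (rule finite_measure_subadditive_countably[OF _ PA]) (use A in auto)
  also have "\<dots> \<le> suminf g" by (rule suminf_le[OF Ag PA g])
  also have "\<dots> \<le> \<sigma>" by (rule suminf_le_const[OF g partial])
  finally show ?thesis .
qed

lemma sets_Haar_pattern: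
  assumes "finite J" "I \<subseteq> {1..}"
  shows "{\<omega> \<in> space (Haar b). pattern b I J a \<omega> n} \<in> sets (Haar b)"
  unfolding pattern_def
proof (rule sets.sets_Collect_finite_All[OF _ assms(1)])
  fix j
  have "Measurable.pred (Haar b) (\<lambda>\<omega>. hits b I \<omega> (n + j))"
    using sets_Haar_hits[OF assms(2)] by (simp add: pred_def)
  then have "Measurable.pred (Haar b) (\<lambda>\<omega>. hits b I \<omega> (n + j) \<longleftrightarrow> a j = 0)"
    by measurable
  then show "{\<omega> \<in> space (Haar b). hits b I \<omega> (n + j) \<longleftrightarrow> a j = 0} \<in> sets (Haar b)"
    by (simp add: pred_def)
qed

text \<open>Rotating the point by the constant sequence \<open>n\<close> amounts to advancing time
  by \<open>n\<close>, since reducing residues does not affect congruences. Restricting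
  \<open>I\<close> keeps away from the index 0, where \<open>translate\<close> takes a default
  value.\<close>

lemma pattern_translate:
  assumes "I \<subseteq> {1..}"
  shows "pattern b I J a (translate b (\<lambda>_. n) \<omega>) 0 \<longleftrightarrow> pattern b I J a \<omega> n"
proof (rule pattern_cong)
  fix j
  have "[(\<omega> k + n) mod b k + j = 0] (mod b k) \<longleftrightarrow> [\<omega> k + (n + j) = 0] (mod b k)" for k
    by (simp add: cong_def mod_simps add.assoc)
  then show "hits b I (translate b (\<lambda>_. n) \<omega>) (0 + j) \<longleftrightarrow> hits b I \<omega> (n + j)"
    using assms unfolding hits_def translate_def by (intro bex_cong) auto
qed

lemma pattern_periodic:
  assumes "finite I"
  shows "pattern b I J a \<omega> (n + (\<Prod>k\<in>I. b k)) \<longleftrightarrow> pattern b I J a \<omega> n"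
proof (rule pattern_cong)
  fix j
  have "[\<omega> k + (n + (\<Prod>k\<in>I. b k) + j) = 0] (mod b k) \<longleftrightarrow> [\<omega> k + (n + j) = 0] (mod b k)"
    if k: "k \<in> I" for k
  proof -
    have "b k dvd (\<Prod>k\<in>I. b k)" using assms k by (rule dvd_prodI)
    then obtain c where "(\<Prod>k\<in>I. b k) = b k * c" by (rule dvdE)
    then have "\<omega> k + (n + (\<Prod>k\<in>I. b k) + j) = \<omega> k + (n + j) + b k * c" by simp
    then show ?thesis by (simp only: cong_def mod_mult_self2)
  qed
  then show "hits b I \<omega> (n + (\<Prod>k\<in>I. b k) + j) \<longleftrightarrow> hits b I \<omega> (n + j)"
    unfolding hits_def by (intro bex_cong) auto
qed

text \<open>Averaging the translation invariance over a full period reduces the claim to the fact that the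
  orbit sum is the same for every starting point \<open>\<omega>\<close>: by the Chinese remainder theorem, \<open>\<omega>\<close> agrees on
  \<open>I\<close> with a translate of \<open>0\<close>.\<close>

lemma measure_Haar_pattern:
  assumes pos: "\<And>k. k \<ge> 1 \<Longrightarrow> b k > 0" and I: "finite I" "I \<subseteq> {1..}" and J: "finite J"
    and cop: "\<And>i k. i \<in> I \<Longrightarrow> k \<in> I \<Longrightarrow> i \<noteq> k \<Longrightarrow> coprime (b i) (b k)"
  shows "measure (Haar b) {\<omega> \<in> space (Haar b). pattern b I J a \<omega> 0}
    = (\<Sum>n<(\<Prod>k\<in>I. b k). of_bool (pattern b I J a (\<lambda>_. 0) n)) / real (\<Prod>k\<in>I. b k)"
proof -
  interpret prob_space "Haar b" by (rule prob_space_Haar[OF pos])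
  define P where "P = (\<Prod>k\<in>I. b k)"
  have P: "P > 0" using pos I by (auto simp: P_def intro!: prod_pos)
  define f where "f \<omega> n = (of_bool (pattern b I J a \<omega> n) :: real)" for \<omega> n
  define A where "A n = {\<omega> \<in> space (Haar b). pattern b I J a \<omega> n}" for n
  have A: "A n \<in> events" for n unfolding A_def by (rule sets_Haar_pattern[OF J I(2)])
  have eq: "prob (A n) = prob (A 0)" for n
  proof -
    have m: "translate b (\<lambda>_. n) \<in> measurable (Haar b) (Haar b)"
      by (rule measurable_translate[OF pos])
    have "prob (A 0) = measure (distr (Haar b) (Haar b) (translate b (\<lambda>_. n))) (A 0)"
      by (simp add: Haar_translation_invariant[of b, OF pos])
    also have "\<dots> = prob (translate b (\<lambda>_. n) -` A 0 \<inter> space (Haar b))"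
      by (rule measure_distr[OF m A])
    also have "translate b (\<lambda>_. n) -` A 0 \<inter> space (Haar b) = A n"
      using measurable_space[OF m] by (auto simp: A_def pattern_translate[OF I(2)])
    finally show ?thesis by simp
  qed
  have orbit: "(\<Sum>n<P. f \<omega> n) = (\<Sum>n<P. f (\<lambda>_. 0) n)" for \<omega>
  proof -
    obtain x where x: "\<forall>k\<in>I. [x = \<omega> k] (mod b k)"
      using chinese_remainder_nat[OF I(1)] cop by blast
    have "f \<omega> n = f (\<lambda>_. 0) (n + x)" for n
    proof -
      have "pattern b I J a \<omega> n \<longleftrightarrow> pattern b I J a (\<lambda>_. 0) (n + x)"
      proof (rule pattern_cong)
        fix j
        have "[\<omega> k + (n + j) = 0] (mod b k) \<longleftrightarrow> [0 + (n + x + j) = 0] (mod b k)" if "k \<in> I" for k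
        proof -
          have "[x + (n + j) = \<omega> k + (n + j)] (mod b k)"
            using x that by (intro cong_add) auto
          then show ?thesis by (simp add: cong_def ac_simps)
        qed
        then show "hits b I \<omega> (n + j) \<longleftrightarrow> hits b I (\<lambda>_. 0) (n + x + j)"
          unfolding hits_def by (intro bex_cong) auto
      qed
      then show ?thesis by (simp add: f_def)
    qed
    then have "(\<Sum>n<P. f \<omega> n) = (\<Sum>n<P. f (\<lambda>_. 0) (n + x))" by simp
    also have "\<dots> = (\<Sum>n<P. f (\<lambda>_. 0) n)"
      by (rule sum_period) (simp add: f_def P_def pattern_periodic[OF I(1)])
    finally show ?thesis .
  qed
  have "(\<Sum>n<P. prob (A n)) = (\<Sum>n<P. prob (A 0))" by (rule sum.cong[OF refl eq])
  then have "real P * prob (A 0) = (\<Sum>n<P. prob (A n))" by simp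
  also have "\<dots> = (\<Sum>n<P. integral\<^sup>L (Haar b) (indicator (A n)))"
    by (rule sum.cong) (auto simp: A_def intro!: arg_cong[where f = prob])
  also have "\<dots> = (\<integral>\<omega>. (\<Sum>n<P. indicator (A n) \<omega>) \<partial>Haar b)"
    by (rule Bochner_Integration.integral_sum[symmetric]) (use A in \<open>auto simp: emeasure_eq_measure\<close>)
  \<comment> \<open>By \<open>orbit\<close> the integrand does not depend on the point, so
    integrating against a probability returns its value at 0.\<close>
  also have "\<dots> = (\<integral>\<omega>. (\<Sum>n<P. f (\<lambda>_. 0) n) \<partial>Haar b)"
  proof (rule Bochner_Integration.integral_cong[OF refl])
    fix \<omega> assume "\<omega> \<in> space (Haar b)"
    then have "(\<Sum>n<P. indicator (A n) \<omega>) = (\<Sum>n<P. f \<omega> n)"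
      by (intro sum.cong) (auto simp: A_def f_def)
    then show "(\<Sum>n<P. indicator (A n) \<omega>) = (\<Sum>n<P. f (\<lambda>_. 0) n)" using orbit[of \<omega>] by simp
  qed
  also have "\<dots> = (\<Sum>n<P. f (\<lambda>_. 0) n)" by (simp add: prob_space)
  finally have "prob (A 0) = (\<Sum>n<P. f (\<lambda>_. 0) n) / real P"
    using P by (simp add: field_simps)
  then show ?thesis by (simp only: A_def f_def P_def)
qed

section \<open>Truncation error and conclusion\<close>

lemma window_shift:
  assumes "eventually (\<lambda>N. real (card {n \<in> window N. Q n}) \<le> c * sqrt (real N)) sequentially" "c \<ge> 0"
  shows "eventually (\<lambda>N. real (card {n \<in> window N. Q (n + j)}) \<le> 2 * c * sqrt (real N)) sequentially"
proof -
  have "eventually (\<lambda>N. real (card {n \<in> window (N + j). Q n}) \<le> c * sqrt (real (N + j))) sequentially"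
    using assms(1) by (rule sequentially_offset)
  then show ?thesis
    using eventually_ge_at_top[of j]
  proof eventually_elim
    case (elim N)
    \<comment> \<open>Translating the window at \<open>N\<close> by \<open>j\<close> lands inside
      the window at \<open>N + j\<close>, which is at least as long.\<close>
    have le: "sqrt (real N) \<le> sqrt (real (N + j))" by simp
    have "n + j \<in> window (N + j)" if "n \<in> window N" for n
      using that le by (simp add: window_def del: real_sqrt_le_iff)
    then have "(\<lambda>n. n + j) ` {n \<in> window N. Q (n + j)} \<subseteq> {n \<in> window (N + j). Q n}"
      by auto
    then have "card {n \<in> window N. Q (n + j)} \<le> card {n \<in> window (N + j). Q n}"
      by (intro card_inj_on_le[of "\<lambda>n. n + j"]) auto
    then have "real (card {n \<in> window N. Q (n + j)}) \<le> c * sqrt (real (N + j))"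
      using elim(1) by linarith
    \<comment> \<open>For \<open>N \<ge> j\<close>, \<open>N + j\<close> is at most
      \<open>2 * N\<close>, hence at most \<open>4 * N\<close>, whose square root is
      \<open>2 * sqrt N\<close>.\<close>
    also have "sqrt (real (N + j)) \<le> sqrt (2\<^sup>2 * real N)" using elim(2) by simp
    also have "\<dots> = 2 * sqrt (real N)" by (simp add: real_sqrt_mult)
    finally show ?case using assms(2) by (simp add: mult_left_mono)
  qed
qed

theorem theorem4p5:
  fixes B :: "nat set" and b :: "nat \<Rightarrow> nat" and C :: "(nat \<Rightarrow> nat) set"
  assumes "infinite B"
    and "B \<subseteq> {2..}"
    and "bij_betw b {1..} B"
    and "pairwise coprime B"
    and "(\<lambda>k. 1 / real (b k)) summable_on {1..}"
    and "\<exists>M::nat. eventually (\<lambda>x::real. card {m \<in> B. x \<le> real m \<and> real m \<le> x + sqrt x} \<le> M) at_top"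
    and "cylinder C"
  shows "(\<lambda>N::nat. 1 / sqrt (real N) *
            (\<Sum>n | N \<le> n \<and> real n < real N + sqrt (real N). indicator C ((shift ^^ n) (eta b))))
         \<longlonglongrightarrow> measure (nu b) C"
proof -
  obtain J a where J: "finite J" "J \<subseteq> {1..}" and a: "a \<in> J \<rightarrow> {0, 1}"
    and C: "C = {x \<in> X. \<forall>n\<in>J. x n = a n}"
    using assms(7) unfolding cylinder_def by blast
  obtain M where M: "eventually (\<lambda>x::real. card {m \<in> B. x \<le> real m \<and> real m \<le> x + sqrt x} \<le> M) at_top"
    using assms(6) by blast
  have inj: "inj_on b {1..}" and img: "b ` {1..} = B"
    using assms(3) by (auto simp: bij_betw_def)
  have pos: "b k > 0" if "k \<ge> 1" for k
    using img assms(2) that by force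
  have B1: "B \<subseteq> {1..}" using assms(2) by auto
  have sumB: "(\<lambda>m. 1 / real m) summable_on B"
    using summable_on_reindex_bij_betw[OF assms(3), of "\<lambda>m. 1 / real m"] assms(5) by simp
  define f where "f I n = (of_bool (pattern b I J a (\<lambda>_. 0) n) :: real)" for I n
  have ind: "indicator C ((shift ^^ n) (eta b)) = f {1..} n" for n
    unfolding f_def C using shift_eta_in_cylinder_iff[OF J(2) a, of n b] by (simp add: indicator_def)
  define \<nu> where "\<nu> = measure (nu b) C"
  have \<nu>: "\<nu> = measure (Haar b) {\<omega> \<in> space (Haar b). pattern b {1..} J a \<omega> 0}"
    unfolding \<nu>_def measure_nu_cylinder[OF assms(7)] unfolding C
    using phi_in_cylinder_iff[OF J(2) a, of b] by (intro arg_cong[where f = "measure (Haar b)"]) blast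
  interpret prob_space "Haar b" by (rule prob_space_Haar[OF pos])
  have "(\<lambda>N. 1 / sqrt (real N) * (\<Sum>n\<in>window N. f {1..} n)) \<longlonglongrightarrow> \<nu>"
  proof (rule LIMSEQ_I)
    fix \<epsilon> :: real assume \<epsilon>: "\<epsilon> > 0"
    define c where "c = real (card J)"
    \<comment> \<open>The total truncation error will be \<open>11 * c * \<sigma>\<close>: 10 parts
      from the window, where the 5 of the sieve bound is doubled by shifting, and 1 part from the
      measure. Using \<open>c + 1\<close> covers an empty \<open>J\<close>.\<close>
    define \<sigma> where "\<sigma> = \<epsilon> / (11 * (c + 1) * 2)"
    have c: "c \<ge> 0" by (simp add: c_def)
    have \<sigma>: "\<sigma> > 0" "11 * c * \<sigma> < \<epsilon> / 2" using \<epsilon> c by (auto simp: \<sigma>_def field_simps)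
    obtain I where I: "finite I" "I \<subseteq> {1..}"
      "\<And>G. finite G \<Longrightarrow> G \<subseteq> {1..} - I \<Longrightarrow> (\<Sum>k\<in>G. 1 / real (b k)) \<le> \<sigma>"
      using summable_on_small_tails[OF assms(5) _ \<sigma>(1)] by auto
    define R where "R = {1..} - I"
    have R: "R \<subseteq> {1..}" by (auto simp: R_def)
    have DB: "b ` R \<subseteq> B" using img R by blast
    \<comment> \<open>The tail bound is indexed by \<open>k\<close>, the sieve by the moduli
      themselves; injectivity of \<open>b\<close> transfers it.\<close>
    have D: "(\<Sum>m\<in>G. 1 / real m) \<le> \<sigma>" if G: "finite G" "G \<subseteq> b ` R" for G
    proof -
      obtain H where H: "H \<subseteq> R" "G = b ` H" using G(2) by (auto simp: subset_image_iff)
      have inH: "inj_on b H" using inj H(1) R by (meson inj_on_subset order_trans)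
      then have "finite H" using G(1) H(2) by (simp add: finite_image_iff)
      moreover have "(\<Sum>m\<in>G. 1 / real m) = (\<Sum>k\<in>H. 1 / real (b k))"
        using inH H(2) by (simp add: sum.reindex)
      ultimately show ?thesis using I(3)[of H] H(1) by (simp add: R_def)
    qed
    define \<mu> where "\<mu> = measure (Haar b) {\<omega> \<in> space (Haar b). pattern b I J a \<omega> 0}"
    have cop: "coprime (b i) (b k)" if "i \<in> I" "k \<in> I" "i \<noteq> k" for i k
    proof -
      have "b i \<noteq> b k" using inj_onD[OF inj, of i k] that I(2) by blast
      moreover have "b i \<in> B" "b k \<in> B" using that I(2) img by auto
      ultimately show ?thesis using assms(4) by (simp add: pairwise_def)
    qed
    have P: "(\<Prod>k\<in>I. b k) > 0" using pos I(2) by (auto intro!: prod_pos)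
    have \<mu>: "\<mu> = (\<Sum>n<(\<Prod>k\<in>I. b k). f I n) / real (\<Prod>k\<in>I. b k)"
      unfolding \<mu>_def f_def by (rule measure_Haar_pattern[of b, OF pos I(1,2) J(1) cop])
    have lim: "(\<lambda>N. 1 / sqrt (real N) * (\<Sum>n\<in>window N. f I n)) \<longlonglongrightarrow> \<mu>"
      unfolding \<mu> f_def
      by (rule window_average_periodic[OF _ P]) (simp_all add: pattern_periodic[OF I(1)])
    have ev1: "eventually (\<lambda>N. norm (1 / sqrt (real N) * (\<Sum>n\<in>window N. f I n) - \<mu>) < \<epsilon> / 2) sequentially"
      using LIMSEQ_D[OF lim, of "\<epsilon> / 2"] \<epsilon> by (auto simp: eventually_sequentially)
    have hitsD: "hits b R (\<lambda>_. 0) n \<longleftrightarrow> (\<exists>m\<in>b ` R. m dvd n)" for n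
      by (simp add: hits_def cong_0_iff)
    have "eventually (\<lambda>N. real (card {n \<in> window N. hits b R (\<lambda>_. 0) (n + j)})
        \<le> 10 * \<sigma> * sqrt (real N)) sequentially" for j
      using window_shift[OF card_window_multiples[OF B1 sumB M \<sigma>(1) DB D], of j] \<sigma>(1)
      by (simp add: hitsD)
    then have ev2: "eventually (\<lambda>N. \<forall>j\<in>J. real (card {n \<in> window N. hits b R (\<lambda>_. 0) (n + j)})
        \<le> 10 * \<sigma> * sqrt (real N)) sequentially"
      by (intro eventually_ball_finite[OF J(1)]) simp
    \<comment> \<open>The full and truncated events agree off the union of the \<open>U j\<close>,
      one for each coordinate in \<open>J\<close> and each of probability at most
      \<open>\<sigma>\<close>.\<close>
    have \<mu>\<nu>: "\<bar>\<mu> - \<nu>\<bar> \<le> c * \<sigma>"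
    proof -
      define U where "U j = {\<omega> \<in> space (Haar b). hits b R \<omega> j}" for j
      define E where "E K = {\<omega> \<in> space (Haar b). pattern b K J a \<omega> 0}" for K
      have U: "U j \<in> events" "prob (U j) \<le> \<sigma>" for j
        using sets_Haar_hits[OF R] measure_Haar_hits_le[of b, OF pos R, of \<sigma>] I(3)
        by (auto simp: U_def R_def)
      have UU: "(\<Union>j\<in>J. U j) \<in> events" using U J(1) by auto
      have "prob (\<Union>j\<in>J. U j) \<le> (\<Sum>j\<in>J. prob (U j))"
        by (rule finite_measure_subadditive_finite) (use J(1) U in auto)
      also have "\<dots> \<le> (\<Sum>j\<in>J. \<sigma>)" using U by (intro sum_mono) auto
      finally have V: "prob (\<Union>j\<in>J. U j) \<le> c * \<sigma>" by (simp add: c_def)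
      have E: "E K \<in> events" if "K \<subseteq> {1..}" for K
        unfolding E_def by (rule sets_Haar_pattern[OF J(1) that])
      have eq: "pattern b {1..} J a \<omega> 0 \<longleftrightarrow> pattern b I J a \<omega> 0"
        if "\<omega> \<in> space (Haar b)" "\<omega> \<notin> (\<Union>j\<in>J. U j)" for \<omega>
        by (rule pattern_truncate[OF I(2)]) (use that in \<open>auto simp: U_def R_def\<close>)
      have bound: "prob A \<le> prob A' + c * \<sigma>"
        if "A \<in> events" "A' \<in> events" "A \<subseteq> A' \<union> (\<Union>j\<in>J. U j)" for A A'
      proof -
        have "prob A \<le> prob (A' \<union> (\<Union>j\<in>J. U j))"
          by (rule finite_measure_mono[OF that(3)]) (use that UU in blast)
        also have "\<dots> \<le> prob A' + prob (\<Union>j\<in>J. U j)"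
          by (rule measure_Un_le[OF that(2) UU])
        finally show ?thesis using V by linarith
      qed
      have "E I \<subseteq> E {1..} \<union> (\<Union>j\<in>J. U j)" "E {1..} \<subseteq> E I \<union> (\<Union>j\<in>J. U j)"
        using eq unfolding E_def by blast+
      then have "prob (E I) \<le> prob (E {1..}) + c * \<sigma>" "prob (E {1..}) \<le> prob (E I) + c * \<sigma>"
        using bound E I(2) by auto
      then show ?thesis unfolding \<mu>_def \<nu> E_def by linarith
    qed
    have "eventually (\<lambda>N. norm (1 / sqrt (real N) * (\<Sum>n\<in>window N. f {1..} n) - \<nu>) < \<epsilon>) sequentially"
      using ev1 ev2 eventually_gt_at_top[of 0]
    proof eventually_elim
      case (elim N)
      define s where "s = sqrt (real N)"
      have s: "s > 0" using elim(3) by (simp add: s_def)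
      \<comment> \<open>Two indicators differ by at most 1, and here only if a discarded modulus
        hits some coordinate. Summing over the coordinates lets the sieve bound be used for each
        \<open>j\<close> separately.\<close>
      have pointwise: "\<bar>f {1..} n - f I n\<bar> \<le> (\<Sum>j\<in>J. of_bool (hits b R (\<lambda>_. 0) (n + j)))" for n
      proof (cases "\<exists>j\<in>J. hits b R (\<lambda>_. 0) (n + j)")
        case True
        then obtain j where "j \<in> J" "hits b R (\<lambda>_. 0) (n + j)" by blast
        then have "1 \<le> (\<Sum>j\<in>J. of_bool (hits b R (\<lambda>_. 0) (n + j)) :: real)"
          using member_le_sum[of j J "\<lambda>j. of_bool (hits b R (\<lambda>_. 0) (n + j)) :: real"] J(1) by simp
        moreover have "\<bar>f {1..} n - f I n\<bar> \<le> 1" by (simp add: f_def)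
        ultimately show ?thesis by linarith
      next
        case False
        then have "pattern b {1..} J a (\<lambda>_. 0) n \<longleftrightarrow> pattern b I J a (\<lambda>_. 0) n"
          by (intro pattern_truncate[OF I(2)]) (auto simp: R_def)
        then show ?thesis by (simp add: f_def sum_nonneg)
      qed
      have "\<bar>(\<Sum>n\<in>window N. f {1..} n) - (\<Sum>n\<in>window N. f I n)\<bar>
          = \<bar>\<Sum>n\<in>window N. f {1..} n - f I n\<bar>"
        by (simp add: sum_subtractf)
      also have "\<dots> \<le> (\<Sum>n\<in>window N. \<Sum>j\<in>J. of_bool (hits b R (\<lambda>_. 0) (n + j)))"
        by (rule order_trans[OF sum_abs sum_mono]) (rule pointwise)
      also have "\<dots> = (\<Sum>j\<in>J. real (card {n \<in> window N. hits b R (\<lambda>_. 0) (n + j)}))"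
        by (subst sum.swap) (simp add: sum_of_bool_eq Collect_conj_eq)
      also have "\<dots> \<le> (\<Sum>j\<in>J. 10 * \<sigma> * s)"
        using elim(2) by (intro sum_mono) (simp add: s_def)
      also have "\<dots> = 10 * c * \<sigma> * s" by (simp add: c_def)
      finally have "\<bar>(\<Sum>n\<in>window N. f {1..} n) - (\<Sum>n\<in>window N. f I n)\<bar> / s \<le> 10 * c * \<sigma>"
        using s by (simp add: pos_divide_le_eq)
      then have "\<bar>1 / s * (\<Sum>n\<in>window N. f {1..} n) - 1 / s * (\<Sum>n\<in>window N. f I n)\<bar> \<le> 10 * c * \<sigma>"
        using s by (simp flip: diff_divide_distrib)
      moreover have "\<bar>1 / s * (\<Sum>n\<in>window N. f I n) - \<mu>\<bar> < \<epsilon> / 2"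
        using elim(1) by (simp add: s_def)
      \<comment> \<open>Three errors add up: \<open>10 * c * \<sigma>\<close> for truncating the
        orbit, less than \<open>\<epsilon> / 2\<close> for the periodic average, and
        \<open>c * \<sigma>\<close> for truncating the measure.\<close>
      ultimately show ?case
        using \<mu>\<nu> \<sigma>(2) unfolding s_def real_norm_def by linarith
    qed
    then show "\<exists>n0. \<forall>N\<ge>n0. norm (1 / sqrt (real N) * (\<Sum>n\<in>window N. f {1..} n) - \<nu>) < \<epsilon>"
      by (simp add: eventually_sequentially)
  qed
  then show ?thesis by (simp add: ind window_def \<nu>_def)
qed

end
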